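(* For every BPPS instance (with $k$ a valid upper bound on the number of bins and $\mathcal B=\{1,\dots,k\}$), an optimal solution to the linear program $\mathrm{LP}^{\ddagger}_{\mathrm N}$ is $$x_{ib}=\frac1k\ \ (i\in\mathcal I,\ b\in\mathcal B),\qquad y_{cb}=\frac{\gamma_c}{k}\ \ (c\in\mathcal C,\ b\in\mathcal B),\qquad z_b=\frac{\check k}{k}\ \ (b\in\mathcal B),$$ and its optimal objective function value is $$\zeta(\mathrm{LP}^{\ddagger}_{\mathrm N})=r\,\check k+\sum_{c\in\mathcal C}\gamma_c\,f_c.$$
   Context: Bin Packing Problem with Setups (BPPS). An instance consists of: a bin capacity $d\in\mathbb Z_{\ge1}$; items $\mathcal I=\{1,\dots,n\}$ with weights $w_i\in\mathbb Z_{\ge1}$; classes $\mathcal C=\{1,\dots,m\}$ and a partition $\{\mathcal I_1,\dots,\mathcal I_m\}$ of $\mathcal I$ into (nonempty) classes; for each class $c$ a setup weight $s_c\in\mathbb Z_{\ge0}$ and a setup cost $f_c\in\mathbb Z_{\ge0}$; a bin cost $r\in\mathbb Z_{\ge1}$. It is assumed that $w_i+s_c\le d$ for all $c\in\mathcal C$, $i\in\mathcal I_c$, and that the items cannot all be packed in a single bin, i.e. $\sum_{i\in\mathcal I}w_i+\sum_{c\in\mathcal C}s_c>d$. For $S\subseteq\mathcal I$ let $\mathcal C(S)=\{c\in\mathcal C: S\cap\mathcal I_c\neq\emptyset\}$. A packing pattern is a subset $S\subseteq\mathcal I$ with $\sum_{i\in S}w_i+\sum_{c\in\mathcal C(S)}s_c\le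 d$. A feasible solution is a partition $\mathcal S$ of $\mathcal I$ into (nonempty) packing patterns (used bins); its cost is $r|\mathcal S|+\sum_{S\in\mathcal S}\sum_{c\in\mathcal C(S)}f_c$. The problem is to find a feasible solution of minimum cost. For $c\in\mathcal C$ let $\gamma_c=\left\lceil\frac{\sum_{i\in\mathcal I_c}w_i}{d-s_c}\right\rceil$, and let $\check k=\left\lceil\frac{\sum_{i\in\mathcal I}w_i+\sum_{c\in\mathcal C}\gamma_c s_c}{d}\right\rceil$. Let $k\in\mathbb Z_{\ge1}$ be an upper bound on the number of bins used in any optimal BPPS solution and $\mathcal B=\{1,\dots,k\}$. The linear program $\mathrm{LP}^{\ddagger}_{\mathrm N}$ is: minimize $\sum_{b\in\mathcal B}\big(r z_b+\sum_{c\in\mathcal C}f_c y_{cb}\big)$ subject to - $\sum_{b\in\mathcal B}x_{ib}=1$ for all $i\in\mathcal I$; - $\sum_{i\in\mathcal I}w_ix_{ib}+\sum_{c\in\mathcal C}s_cy_{cb}\le d\,z_b$ for all $b\in\mathcal B$; - $x_{ib}\le y_{cb}$ for all $c\in\mathcal C$, $i\in\mathcal I_c$, $b\in\mathcal B$; - $\sum_{b\in\mathcal B}y_{cb}\ge\gamma_c$ for all $c\in\mathcal C$ (Minimum Classes Inequalities); - $\sum_{b\in\mathcal B}z_b\ge\check k$ (Minimum Bins Inequality); - $0\le x_{ib}\le1$, $0\le y_{cb}\le1$, $0\le z_b\le1$ for all $i\in\mathcal I,c\in\mathcal C,b\in\mathcal B$. $\zeta(\mathrm{LP}^{\ddagger}_{\mathrm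 N})$ denotes its optimal objective function value. *)

theory Defs
  imports Complex_Main "HOL-Library.Disjoint_Sets"
begin

record bpps =
  num_items :: nat
  num_classes :: nat
  capacity :: nat
  weight :: "nat \<Rightarrow> nat"
  class_items :: "nat \<Rightarrow> nat set"
  setup_weight :: "nat \<Rightarrow> nat"
  setup_cost :: "nat \<Rightarrow> nat"
  bin_cost :: nat

definition items :: "bpps \<Rightarrow> nat set" where
  "items P = {1..num_items P}"

definition classes :: "bpps \<Rightarrow> nat set" where
  "classes P = {1..num_classes P}"

text \<open>Setup weights and setup costs may be zero, so they carry no positivity condition.\<close>

definition bpps_instance :: "bpps \<Rightarrow> bool" where
  "bpps_instance P \<longleftrightarrow>
     capacity P \<ge> 1 \<and> bin_cost P \<ge> 1 \<and>
     (\<forall>i\<in>items P. weight P i \<ge> 1) \<and>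
     (\<forall>c\<in>classes P. class_items P c \<noteq> {}) \<and>
     disjoint_family_on (class_items P) (classes P) \<and>
     (\<Union>c\<in>classes P. class_items P c) = items P \<and>
     (\<forall>c\<in>classes P. \<forall>i\<in>class_items P c. weight P i + setup_weight P c \<le> capacity P) \<and>
     (\<Sum>i\<in>items P. weight P i) + (\<Sum>c\<in>classes P. setup_weight P c) > capacity P"

definition classes_of :: "bpps \<Rightarrow> nat set \<Rightarrow> nat set" where
  "classes_of P S = {c \<in> classes P. S \<inter> class_items P c \<noteq> {}}"

definition packing_pattern :: "bpps \<Rightarrow> nat set \<Rightarrow> bool" where
  "packing_pattern P S \<longleftrightarrow>
     S \<subseteq> items P \<and>
     (\<Sum>i\<in>S. weight P i) + (\<Sum>c\<in>classes_of P S. setup_weight P c) \<le> capacity P"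

definition bpps_feasible :: "bpps \<Rightarrow> nat set set \<Rightarrow> bool" where
  "bpps_feasible P \<S> \<longleftrightarrow> partition_on (items P) \<S> \<and> (\<forall>S\<in>\<S>. packing_pattern P S)"

definition bpps_cost :: "bpps \<Rightarrow> nat set set \<Rightarrow> nat" where
  "bpps_cost P \<S> =
     bin_cost P * card \<S> + (\<Sum>S\<in>\<S>. \<Sum>c\<in>classes_of P S. setup_cost P c)"

definition bpps_optimal :: "bpps \<Rightarrow> nat set set \<Rightarrow> bool" where
  "bpps_optimal P \<S> \<longleftrightarrow>
     bpps_feasible P \<S> \<and> (\<forall>\<T>. bpps_feasible P \<T> \<longrightarrow> bpps_cost P \<S> \<le> bpps_cost P \<T>)"

definition bin_bound :: "bpps \<Rightarrow> nat \<Rightarrow> bool" where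
  "bin_bound P k \<longleftrightarrow> (\<forall>\<S>. bpps_optimal P \<S> \<longrightarrow> card \<S> \<le> k)"

text \<open>The subtraction is taken in the reals, not truncated.\<close>

definition min_bins_class :: "bpps \<Rightarrow> nat \<Rightarrow> int" where
  "min_bins_class P c =
     \<lceil>real (\<Sum>i\<in>class_items P c. weight P i) / (real (capacity P) - real (setup_weight P c))\<rceil>"

definition min_bins :: "bpps \<Rightarrow> int" where
  "min_bins P =
     \<lceil>(real (\<Sum>i\<in>items P. weight P i)
        + (\<Sum>c\<in>classes P. real_of_int (min_bins_class P c) * real (setup_weight P c)))
      / real (capacity P)\<rceil>"

text \<open>
  The linear program has variables \<open>x i b\<close>, \<open>y c b\<close>, \<open>z b\<close>. Only their values at items \<open>i\<close>,
  classes \<open>c\<close> and bins \<open>b \<in> {1..k}\<close> matter.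
\<close>

definition lp_objective ::
  "bpps \<Rightarrow> nat \<Rightarrow> (nat \<Rightarrow> nat \<Rightarrow> real) \<Rightarrow> (nat \<Rightarrow> real) \<Rightarrow> real" where
  "lp_objective P k y z =
     (\<Sum>b\<in>{1..k}. real (bin_cost P) * z b + (\<Sum>c\<in>classes P. real (setup_cost P c) * y c b))"

definition lp_feasible ::
  "bpps \<Rightarrow> nat \<Rightarrow> (nat \<Rightarrow> nat \<Rightarrow> real) \<Rightarrow> (nat \<Rightarrow> nat \<Rightarrow> real) \<Rightarrow> (nat \<Rightarrow> real) \<Rightarrow> bool" where
  "lp_feasible P k x y z \<longleftrightarrow>
     (\<forall>i\<in>items P. (\<Sum>b\<in>{1..k}. x i b) = 1) \<and>
     (\<forall>b\<in>{1..k}. (\<Sum>i\<in>items P. real (weight P i) * x i b)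
                    + (\<Sum>c\<in>classes P. real (setup_weight P c) * y c b)
                  \<le> real (capacity P) * z b) \<and>
     (\<forall>c\<in>classes P. \<forall>i\<in>class_items P c. \<forall>b\<in>{1..k}. x i b \<le> y c b) \<and>
     (\<forall>c\<in>classes P. (\<Sum>b\<in>{1..k}. y c b) \<ge> real_of_int (min_bins_class P c)) \<and>
     (\<Sum>b\<in>{1..k}. z b) \<ge> real_of_int (min_bins P) \<and>
     (\<forall>i\<in>items P. \<forall>b\<in>{1..k}. 0 \<le> x i b \<and> x i b \<le> 1) \<and>
     (\<forall>c\<in>classes P. \<forall>b\<in>{1..k}. 0 \<le> y c b \<and> y c b \<le> 1) \<and>
     (\<forall>b\<in>{1..k}. 0 \<le> z b \<and> z b \<le> 1)"

definition lp_optimal ::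
  "bpps \<Rightarrow> nat \<Rightarrow> (nat \<Rightarrow> nat \<Rightarrow> real) \<Rightarrow> (nat \<Rightarrow> nat \<Rightarrow> real) \<Rightarrow> (nat \<Rightarrow> real) \<Rightarrow> bool" where
  "lp_optimal P k x y z \<longleftrightarrow>
     lp_feasible P k x y z \<and>
     (\<forall>x' y' z'. lp_feasible P k x' y' z' \<longrightarrow> lp_objective P k y z \<le> lp_objective P k y' z')"

text \<open>
  On the reals, \<open>Inf\<close> is the true infimum only for nonempty sets bounded below. Objective values
  of feasible points are nonnegative, so the value is meaningful whenever the program is feasible.
\<close>

definition lp_value :: "bpps \<Rightarrow> nat \<Rightarrow> real" where
  "lp_value P k = Inf {lp_objective P k y z | x y z. lp_feasible P k x y z}"

end

theory Submission
  imports Defs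
begin

text \<open>
  Summing the capacity constraint over all bins and using the two families of minimum inequalities
  bounds the objective from below by the claimed value, and spreading everything evenly over the
  \<open>k\<close> bins attains it. The only real issue is that the even spread respects the upper bounds
  \<open>y \<le> 1\<close> and \<open>z \<le> 1\<close>. This is where \<open>bin_bound\<close> enters: packing each item alone is feasible, so
  an optimal packing exists; it uses at most \<open>k\<close> bins, and counting weights in it shows
  that class \<open>c\<close> meets at least \<open>min_bins_class P c\<close> bins and that there are at least \<open>min_bins P\<close>
  bins in total.
\<close>

section \<open>Basic facts and the existence of an optimal packing\<close>

lemma finite_items: "finite (items P)"
  by (simp add: items_def)

lemma finite_classes: "finite (classes P)"
  by (simp add: classes_def)

lemma class_items_subset:
  assumes "bpps_instance P" "c \<in> classes P"
  shows "class_items P c \<subseteq> items P"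
  using assms unfolding bpps_instance_def by blast

lemma classes_of_singleton:
  assumes "bpps_instance P" "c \<in> classes P" "i \<in> class_items P c"
  shows "classes_of P {i} = {c}"
  using assms unfolding bpps_instance_def classes_of_def disjoint_family_on_def by blast

lemma singletons_feasible:
  assumes "bpps_instance P"
  shows "bpps_feasible P ((\<lambda>i. {i}) ` items P)"
proof -
  have "partition_on (items P) ((\<lambda>i. {i}) ` items P)"
    by (auto simp: partition_on_def disjoint_def)
  moreover have "packing_pattern P {i}" if i: "i \<in> items P" for i
  proof -
    obtain c where c: "c \<in> classes P" "i \<in> class_items P c"
      using assms i unfolding bpps_instance_def by blast
    then have "weight P i + setup_weight P c \<le> capacity P"
      using assms unfolding bpps_instance_def by blast
    then show ?thesis
      using i classes_of_singleton[OF assms c] by (simp add: packing_pattern_def)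
  qed
  ultimately show ?thesis
    by (simp add: bpps_feasible_def)
qed

text \<open>Costs are natural numbers, so a nonempty set of feasible packings has one of least cost.
  Since \<open>bin_bound\<close> speaks only of optimal packings, this is what turns it into a bound
  on an actual packing.\<close>

lemma bpps_optimal_exists:
  assumes "bpps_instance P"
  obtains \<S> where "bpps_optimal P \<S>"
  using ex_has_least_nat[of "bpps_feasible P", OF singletons_feasible[OF assms], of "bpps_cost P"]
  unfolding bpps_optimal_def by blast

section \<open>Signs of the rounded-up bounds\<close>

lemma setup_weight_less_capacity:
  assumes "bpps_instance P" "c \<in> classes P"
  shows "setup_weight P c < capacity P"
proof -
  obtain i where i: "i \<in> class_items P c"
    using assms unfolding bpps_instance_def by blast
  then have "weight P i \<ge> 1" "weight P i + setup_weight P c \<le> capacity P"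
    using assms class_items_subset[OF assms] unfolding bpps_instance_def by blast+
  then show ?thesis by linarith
qed

text \<open>A nonempty class has positive total weight over a positive denominator, and the ceiling
  of a positive number is at least 1. In the even spread this yields
  \<open>x \<le> y\<close>.\<close>

lemma min_bins_class_ge_1:
  assumes "bpps_instance P" "c \<in> classes P"
  shows "min_bins_class P c \<ge> 1"
proof -
  obtain i where i: "i \<in> class_items P c"
    using assms unfolding bpps_instance_def by blast
  have sub: "class_items P c \<subseteq> items P"
    by (rule class_items_subset[OF assms])
  have "weight P i \<le> (\<Sum>j\<in>class_items P c. weight P j)"
    by (rule member_le_sum[OF i]) (auto intro: finite_subset[OF sub finite_items])
  moreover have "weight P i \<ge> 1"
    using assms i sub unfolding bpps_instance_def by blast
  ultimately have "real (\<Sum>j\<in>class_items P c. weight P j) > 0"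
    by linarith
  moreover have "real (capacity P) - real (setup_weight P c) > 0"
    using setup_weight_less_capacity[OF assms] by simp
  ultimately have "real (\<Sum>j\<in>class_items P c. weight P j)
      / (real (capacity P) - real (setup_weight P c)) > 0"
    by (rule divide_pos_pos)
  then show ?thesis
    unfolding min_bins_class_def by linarith
qed

lemma min_bins_nonneg:
  assumes "bpps_instance P"
  shows "min_bins P \<ge> 0"
proof -
  have "(\<Sum>c\<in>classes P. real_of_int (min_bins_class P c) * real (setup_weight P c)) \<ge> 0"
    using min_bins_class_ge_1[OF assms] by (intro sum_nonneg mult_nonneg_nonneg) force+
  then have "(real (\<Sum>i\<in>items P. weight P i)
        + (\<Sum>c\<in>classes P. real_of_int (min_bins_class P c) * real (setup_weight P c)))
      / real (capacity P) \<ge> 0"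
    by (intro divide_nonneg_nonneg add_nonneg_nonneg) (auto intro: sum_nonneg)
  then show ?thesis
    unfolding min_bins_def by linarith
qed

section \<open>Counting weights in a feasible packing\<close>

lemma bpps_feasible_finite:
  assumes "bpps_feasible P \<S>"
  shows "finite \<S>" "S \<in> \<S> \<Longrightarrow> finite S"
  using assms finite_elements[OF finite_items] finite_subset[OF _ finite_items, of S P]
  unfolding bpps_feasible_def packing_pattern_def by blast+

text \<open>The bins cut \<open>A\<close> into disjoint pieces, and bins missing \<open>A\<close>
  contribute an empty sum. It is applied to a single class and to the set of all items.\<close>

lemma sum_feasible:
  assumes "bpps_feasible P \<S>" "A \<subseteq> items P"
  shows "(\<Sum>S\<in>\<S>. \<Sum>i\<in>S \<inter> A. g i) = (\<Sum>i\<in>A. g i :: nat)"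
proof -
  have part: "partition_on (items P) \<S>"
    using assms unfolding bpps_feasible_def by blast
  have "(\<Sum>i\<in>(\<Union>S\<in>\<S>. S \<inter> A). g i) = (\<Sum>S\<in>\<S>. \<Sum>i\<in>S \<inter> A. g i)"
    using part bpps_feasible_finite[OF assms(1)]
    by (intro sum.UNION_disjoint) (auto simp: partition_on_def dest: disjointD)
  moreover have "(\<Union>S\<in>\<S>. S \<inter> A) = A"
    using part assms(2) unfolding partition_on_def by blast
  ultimately show ?thesis by simp
qed

text \<open>Each bin meeting the class pays its setup weight once, which leaves at most the
  remaining capacity for items of the class. The number of such bins is an integer, so the bound
  survives rounding up.\<close>

lemma min_bins_class_le_card:
  assumes inst: "bpps_instance P" and feas: "bpps_feasible P \<S>" and c: "c \<in> classes P"
  shows "min_bins_class P c \<le> int (card {S \<in> \<S>. c \<in> classes_of P S})"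
proof -
  let ?T = "{S \<in> \<S>. c \<in> classes_of P S}"
  let ?I = "class_items P c"
  have pos: "setup_weight P c < capacity P"
    by (rule setup_weight_less_capacity[OF inst c])
  have bound: "(\<Sum>i\<in>S \<inter> ?I. weight P i) \<le> capacity P - setup_weight P c" if "S \<in> ?T" for S
  proof -
    have S: "S \<in> \<S>" and cS: "c \<in> classes_of P S"
      using that by auto
    have "(\<Sum>i\<in>S. weight P i) + (\<Sum>c\<in>classes_of P S. setup_weight P c) \<le> capacity P"
      using feas S unfolding bpps_feasible_def packing_pattern_def by blast
    moreover have "(\<Sum>i\<in>S \<inter> ?I. weight P i) \<le> (\<Sum>i\<in>S. weight P i)"
      using bpps_feasible_finite(2)[OF feas S] by (intro sum_mono2) auto
    moreover have "setup_weight P c \<le> (\<Sum>c\<in>classes_of P S. setup_weight P c)"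
      using finite_classes[of P] by (intro member_le_sum[OF cS]) (auto simp: classes_of_def)
    ultimately show ?thesis by linarith
  qed
  have "(\<Sum>i\<in>?I. weight P i) = (\<Sum>S\<in>\<S>. \<Sum>i\<in>S \<inter> ?I. weight P i)"
    using sum_feasible[OF feas class_items_subset[OF inst c]] by simp
  \<comment> \<open>A bin outside \<open>?T\<close> is disjoint from the class, so its inner sum is
    empty.\<close>
  also have "\<dots> = (\<Sum>S\<in>?T. \<Sum>i\<in>S \<inter> ?I. weight P i)"
    using bpps_feasible_finite(1)[OF feas] c
    by (intro sum.mono_neutral_right) (auto simp: classes_of_def)
  also have "\<dots> \<le> card ?T * (capacity P - setup_weight P c)"
    using sum_bounded_above[of ?T, OF bound] by simp
  finally have "real (\<Sum>i\<in>?I. weight P i) \<le> real (card ?T * (capacity P - setup_weight P c))"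
    by (rule of_nat_mono)
  \<comment> \<open>By \<open>pos\<close> the divisor is positive and the truncated subtraction on
    naturals agrees with the real one.\<close>
  then have "real (\<Sum>i\<in>?I. weight P i) / (real (capacity P) - real (setup_weight P c))
      \<le> real (card ?T)"
    using pos by (simp add: pos_divide_le_eq of_nat_diff)
  then show ?thesis
    unfolding min_bins_class_def by (simp add: ceiling_le_iff)
qed

text \<open>Adding up the loads of all bins counts every item once and the setup of class
  \<open>c\<close> once for each bin that meets it, hence at least \<open>min_bins_class P c\<close>
  times. The total is at most \<open>card \<S>\<close> capacities.\<close>

lemma min_bins_le_card:
  assumes inst: "bpps_instance P" and feas: "bpps_feasible P \<S>"
  shows "min_bins P \<le> int (card \<S>)"
proof -
  let ?n = "\<lambda>c. card {S \<in> \<S>. c \<in> classes_of P S}"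
  have fin: "finite \<S>"
    by (rule bpps_feasible_finite[OF feas])
  \<comment> \<open>Writing the setups with an indicator makes the inner index set independent of
    \<open>S\<close>, so that the two sums can be swapped.\<close>
  have "(\<Sum>S\<in>\<S>. \<Sum>c\<in>classes_of P S. setup_weight P c)
      = (\<Sum>S\<in>\<S>. \<Sum>c\<in>classes P. if c \<in> classes_of P S then setup_weight P c else 0)"
    using finite_classes[of P]
    by (intro sum.cong refl sum.mono_neutral_cong_left) (auto simp: classes_of_def)
  also have "\<dots> = (\<Sum>c\<in>classes P. \<Sum>S\<in>\<S>. if c \<in> classes_of P S then setup_weight P c else 0)"
    by (rule sum.swap)
  also have "\<dots> = (\<Sum>c\<in>classes P. ?n c * setup_weight P c)"
    using fin by (simp add: sum.inter_filter[symmetric])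
  finally have setups: "(\<Sum>S\<in>\<S>. \<Sum>c\<in>classes_of P S. setup_weight P c)
      = (\<Sum>c\<in>classes P. ?n c * setup_weight P c)" .
  have "S \<inter> items P = S" if "S \<in> \<S>" for S
    using feas that unfolding bpps_feasible_def packing_pattern_def by blast
  then have weights: "(\<Sum>S\<in>\<S>. \<Sum>i\<in>S. weight P i) = (\<Sum>i\<in>items P. weight P i)"
    using sum_feasible[OF feas order_refl, of "weight P"] by simp
  have "(\<Sum>S\<in>\<S>. (\<Sum>i\<in>S. weight P i) + (\<Sum>c\<in>classes_of P S. setup_weight P c))
      \<le> card \<S> * capacity P"
    using sum_bounded_above[of \<S> "\<lambda>S. (\<Sum>i\<in>S. weight P i) + (\<Sum>c\<in>classes_of P S. setup_weight P c)"
      "capacity P"] feas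
    unfolding bpps_feasible_def packing_pattern_def by simp
  then have "(\<Sum>i\<in>items P. weight P i) + (\<Sum>c\<in>classes P. ?n c * setup_weight P c)
      \<le> card \<S> * capacity P"
    by (simp add: sum.distrib setups weights)
  then have "real ((\<Sum>i\<in>items P. weight P i) + (\<Sum>c\<in>classes P. ?n c * setup_weight P c))
      \<le> real (card \<S> * capacity P)"
    by (rule of_nat_mono)
  moreover have "(\<Sum>c\<in>classes P. real_of_int (min_bins_class P c) * real (setup_weight P c))
      \<le> (\<Sum>c\<in>classes P. real (?n c) * real (setup_weight P c))"
  proof (intro sum_mono mult_right_mono)
    show "real_of_int (min_bins_class P c) \<le> real (?n c)" if "c \<in> classes P" for c
      using min_bins_class_le_card[OF inst feas that] by linarith
  qed simp
  ultimately have "real (\<Sum>i\<in>items P. weight P i)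
        + (\<Sum>c\<in>classes P. real_of_int (min_bins_class P c) * real (setup_weight P c))
      \<le> real (card \<S>) * real (capacity P)"
    by simp
  moreover have "capacity P > 0"
    using inst unfolding bpps_instance_def by linarith
  ultimately have "(real (\<Sum>i\<in>items P. weight P i)
        + (\<Sum>c\<in>classes P. real_of_int (min_bins_class P c) * real (setup_weight P c)))
      / real (capacity P) \<le> real (card \<S>)"
    by (simp add: pos_divide_le_eq)
  then show ?thesis
    unfolding min_bins_def by (simp add: ceiling_le_iff)
qed

section \<open>Lower bound and even spread for the linear program\<close>

lemma lp_objective_eq:
  "lp_objective P k y z = real (bin_cost P) * (\<Sum>b\<in>{1..k}. z b)
     + (\<Sum>c\<in>classes P. real (setup_cost P c) * (\<Sum>b\<in>{1..k}. y c b))"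
  unfolding lp_objective_def sum.distrib sum_distrib_left
  by (simp add: sum.swap[of _ "classes P"])

text \<open>The objective depends only on the totals of \<open>z\<close> and of each
  \<open>y c\<close> over the bins. The minimum inequalities bound these totals from below, and all
  cost coefficients are nonnegative.\<close>

lemma lp_objective_ge:
  assumes "lp_feasible P k x y z"
  shows "real (bin_cost P) * real_of_int (min_bins P)
      + (\<Sum>c\<in>classes P. real_of_int (min_bins_class P c) * real (setup_cost P c))
    \<le> lp_objective P k y z"
  using assms unfolding lp_objective_eq lp_feasible_def
  by (intro add_mono sum_mono) (auto simp: mult.commute[of "real (setup_cost P _)"]
      intro!: mult_left_mono mult_right_mono)

lemma lp_objective_uniform:
  assumes "k \<ge> 1"
  shows "lp_objective P k (\<lambda>c b. real_of_int (min_bins_class P c) / real k)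
      (\<lambda>b. real_of_int (min_bins P) / real k)
    = real (bin_cost P) * real_of_int (min_bins P)
      + (\<Sum>c\<in>classes P. real_of_int (min_bins_class P c) * real (setup_cost P c))"
  using assms unfolding lp_objective_eq by (simp add: mult.commute)

lemma lp_feasible_uniform:
  assumes inst: "bpps_instance P" and k: "k \<ge> 1" and bound: "bin_bound P k"
  shows "lp_feasible P k (\<lambda>i b. 1 / real k)
    (\<lambda>c b. real_of_int (min_bins_class P c) / real k)
    (\<lambda>b. real_of_int (min_bins P) / real k)"
proof -
  obtain \<S> where opt: "bpps_optimal P \<S>"
    using bpps_optimal_exists[OF inst] .
  have feas: "bpps_feasible P \<S>" and card: "card \<S> \<le> k"
    using opt bound unfolding bpps_optimal_def bin_bound_def by blast+
  have kpos: "real k > 0"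
    using k by simp
  have bins_le: "real_of_int (min_bins P) \<le> real k"
    using min_bins_le_card[OF inst feas] card by linarith
  have class_le: "real_of_int (min_bins_class P c) \<le> real k" if "c \<in> classes P" for c
  proof -
    have "card {S \<in> \<S>. c \<in> classes_of P S} \<le> card \<S>"
      using bpps_feasible_finite(1)[OF feas] by (intro card_mono) auto
    then show ?thesis
      using min_bins_class_le_card[OF inst feas that] card by linarith
  qed
  have class_ge: "real_of_int (min_bins_class P c) \<ge> 1" if "c \<in> classes P" for c
    using min_bins_class_ge_1[OF inst that] by simp
  have bins_ge: "real_of_int (min_bins P) \<ge> 0"
    using min_bins_nonneg[OF inst] by simp
  let ?W = "real (\<Sum>i\<in>items P. weight P i)
      + (\<Sum>c\<in>classes P. real_of_int (min_bins_class P c) * real (setup_weight P c))"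
  have "capacity P > 0"
    using inst unfolding bpps_instance_def by linarith
  \<comment> \<open>\<open>min_bins P\<close> is this quotient rounded up, so the total load
    \<open>?W\<close> fits into \<open>min_bins P\<close> capacities; dividing by \<open>k\<close>
    gives the capacity constraint of each bin.\<close>
  moreover have "?W / real (capacity P) \<le> real_of_int (min_bins P)"
    unfolding min_bins_def by (rule le_of_int_ceiling)
  ultimately have "?W \<le> real (capacity P) * real_of_int (min_bins P)"
    by (simp add: pos_divide_le_eq mult.commute)
  then have "?W / real k \<le> real (capacity P) * real_of_int (min_bins P) / real k"
    by (rule divide_right_mono) simp
  moreover have "(\<Sum>i\<in>items P. real (weight P i) * (1 / real k))
      + (\<Sum>c\<in>classes P. real (setup_weight P c) * (real_of_int (min_bins_class P c) / real k))
    = ?W / real k"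
    by (simp add: add_divide_distrib sum_divide_distrib mult.commute)
  ultimately have cap: "(\<Sum>i\<in>items P. real (weight P i) * (1 / real k))
      + (\<Sum>c\<in>classes P. real (setup_weight P c) * (real_of_int (min_bins_class P c) / real k))
    \<le> real (capacity P) * (real_of_int (min_bins P) / real k)"
    by simp
  have y_ge: "1 / real k \<le> real_of_int (min_bins_class P c) / real k"
    if "c \<in> classes P" for c
    using class_ge[OF that] by (intro divide_right_mono) auto
  have y_bounds: "0 \<le> real_of_int (min_bins_class P c) / real k"
    "real_of_int (min_bins_class P c) / real k \<le> 1" if "c \<in> classes P" for c
    using class_ge[OF that] class_le[OF that] kpos by auto
  have z_bounds: "0 \<le> real_of_int (min_bins P) / real k" "real_of_int (min_bins P) / real k \<le> 1"
    using bins_ge bins_le kpos by auto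
  \<comment> \<open>Stated for arbitrary \<open>a\<close>, so that one rewrite settles the
    assignment equations and both kinds of minimum inequalities.\<close>
  have sum_bins: "(\<Sum>b\<in>{1..k}. a / real k) = a" for a :: real
    using kpos by simp
  have x_bounds: "0 \<le> 1 / real k" "1 / real k \<le> 1"
    using k by auto
  show ?thesis
    unfolding lp_feasible_def sum_bins
    using cap y_ge y_bounds z_bounds x_bounds by blast
qed

theorem proposition8:
  fixes P :: bpps and k :: nat
  assumes "bpps_instance P"
    and "k \<ge> 1"
    and "bin_bound P k"
  shows "lp_optimal P k
           (\<lambda>i b. 1 / real k)
           (\<lambda>c b. real_of_int (min_bins_class P c) / real k)
           (\<lambda>b. real_of_int (min_bins P) / real k)
       \<and> lp_value P k =
           real (bin_cost P) * real_of_int (min_bins P)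
           + (\<Sum>c\<in>classes P. real_of_int (min_bins_class P c) * real (setup_cost P c))"
proof
  note feasible = lp_feasible_uniform[OF assms]
    and objective = lp_objective_uniform[OF assms(2), of P]
  show "lp_optimal P k
      (\<lambda>i b. 1 / real k)
      (\<lambda>c b. real_of_int (min_bins_class P c) / real k)
      (\<lambda>b. real_of_int (min_bins P) / real k)"
    unfolding lp_optimal_def objective using feasible lp_objective_ge by blast
  show "lp_value P k =
      real (bin_cost P) * real_of_int (min_bins P)
      + (\<Sum>c\<in>classes P. real_of_int (min_bins_class P c) * real (setup_cost P c))"
    unfolding lp_value_def
  \<comment> \<open>The lower bound is itself the objective value of the even spread, so the infimum
    is an attained minimum.\<close>
  proof (rule cInf_eq_minimum)
    show "real (bin_cost P) * real_of_int (min_bins P)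
        + (\<Sum>c\<in>classes P. real_of_int (min_bins_class P c) * real (setup_cost P c))
      \<in> {lp_objective P k y z | x y z. lp_feasible P k x y z}"
      using feasible objective[symmetric] by blast
  qed (use lp_objective_ge in blast)
qed

end
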